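(* Let $f:\mathbb{R}^d\to\mathbb{R}$ be a differentiable function whose gradient is $\kappa$-Lipschitz continuous, where $\kappa \ge 0$, i.e. $$\|\nabla f(x)-\nabla f(x')\| \le \kappa\,\|x-x'\| \qquad \text{for all } x,x'\in\mathbb{R}^d.$$ Then for all $x,x'\in\mathbb{R}^d$ and all $\lambda\in[0,1]$, $$\bigl|f(\lambda x+(1-\lambda)x')-[\lambda f(x)+(1-\lambda)f(x')]\bigr| \le \frac{\lambda(1-\lambda)\kappa}{2}\,\|x-x'\|^2 .$$
   Context: $\|\cdot\|$ denotes the Euclidean norm on $\mathbb{R}^d$, and $\nabla f$ is the gradient with respect to the standard inner product. *)

theory Defs
  imports "HOL-Analysis.Analysis"
begin

end

theory Submission
  imports Defs
begin

text \<open>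
  A \<open>\<kappa>\<close>-Lipschitz gradient bounds the first-order Taylor remainder at \<open>z\<close> by
  \<open>\<kappa> / 2 * \<parallel>y - z\<parallel>\<^sup>2\<close>. Expanding at the convex combination
  \<open>z = t x + (1 - t) x'\<close> and averaging the expansions at \<open>x\<close> and \<open>x'\<close> with weights
  \<open>t\<close> and \<open>1 - t\<close> cancels the linear terms, and the remainders add up to
  \<open>t (1 - t)\<^sup>2 + (1 - t) t\<^sup>2 = t (1 - t)\<close>.
\<close>

text \<open>Along the segment from \<open>z\<close> to \<open>y\<close>, the remainder minus its
  quadratic bound is nonincreasing: by Cauchy-Schwarz and the Lipschitz condition its derivative is
  at most 0. This needs no integral of the gradient.\<close>

lemma lipschitz_gradient_upper_bound:
  fixes f :: "'a::real_inner \<Rightarrow> real"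
  assumes gradient: "\<And>x. GDERIV f x :> g x"
    and lipschitz: "\<And>x y. norm (g x - g y) \<le> \<kappa> * norm (x - y)"
  shows "f y - f z - (y - z) \<bullet> g z \<le> \<kappa> / 2 * (norm (y - z))\<^sup>2"
proof -
  define h where "h = y - z"
  \<comment> \<open>The quadratic term is chosen so that its derivative
    \<open>\<kappa> * s * (norm h)\<^sup>2\<close> matches the Lipschitz bound. As
    \<open>\<phi> 0 = f z\<close>, the goal is \<open>\<phi> 1 \<le> \<phi> 0\<close>.\<close>
  define \<phi> where "\<phi> s = f (z + s *\<^sub>R h) - s * (h \<bullet> g z) - \<kappa> / 2 * s\<^sup>2 * (norm h)\<^sup>2" for s :: real
  have deriv: "(\<phi> has_real_derivative
      h \<bullet> (g (z + s *\<^sub>R h) - g z) - \<kappa> * s * (norm h)\<^sup>2) (at s)" for s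
  proof -
    have line: "((\<lambda>s. z + s *\<^sub>R h) has_derivative (\<lambda>u. u *\<^sub>R h)) (at s)"
      by (auto intro!: derivative_eq_intros)
    have "(f has_derivative (\<lambda>v. v \<bullet> g (z + s *\<^sub>R h))) (at (z + s *\<^sub>R h))"
      using gradient by (simp add: gderiv_def)
    from has_derivative_compose[OF line this]
    have "((\<lambda>s. f (z + s *\<^sub>R h)) has_real_derivative h \<bullet> g (z + s *\<^sub>R h)) (at s)"
      by (simp add: has_field_derivative_def mult.commute[of _ "h \<bullet> g (z + s *\<^sub>R h)"])
    then show ?thesis
      unfolding \<phi>_def by (auto intro!: derivative_eq_intros simp: inner_diff_right)
  qed
  \<comment> \<open>The sign of \<open>s\<close> matters: it turns
    \<open>norm (s *\<^sub>R h)\<close> into \<open>s * norm h\<close>.\<close>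
  have nonpos: "h \<bullet> (g (z + s *\<^sub>R h) - g z) - \<kappa> * s * (norm h)\<^sup>2 \<le> 0" if "0 \<le> s" for s
  proof -
    have "h \<bullet> (g (z + s *\<^sub>R h) - g z) \<le> norm h * norm (g (z + s *\<^sub>R h) - g z)"
      by (rule norm_cauchy_schwarz)
    also have "\<dots> \<le> norm h * (\<kappa> * norm (z + s *\<^sub>R h - z))"
      by (intro mult_left_mono lipschitz) simp
    also have "\<dots> = \<kappa> * s * (norm h)\<^sup>2"
      using that by (simp add: power2_eq_square)
    finally show ?thesis by simp
  qed
  have "\<phi> 1 \<le> \<phi> 0"
    by (rule DERIV_nonpos_imp_nonincreasing[where f = \<phi>]) (simp, use deriv nonpos in blast)
  then show ?thesis
    by (simp add: \<phi>_def h_def)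
qed

lemma lipschitz_gradient_convex_combination_upper:
  fixes f :: "'a::real_inner \<Rightarrow> real"
  assumes gradient: "\<And>x. GDERIV f x :> g x"
    and lipschitz: "\<And>x y. norm (g x - g y) \<le> \<kappa> * norm (x - y)"
    and t: "0 \<le> t" "t \<le> 1"
  shows "t * f x + (1 - t) * f y - f (t *\<^sub>R x + (1 - t) *\<^sub>R y)
    \<le> t * (1 - t) * \<kappa> / 2 * (norm (x - y))\<^sup>2"
proof -
  define z where "z = t *\<^sub>R x + (1 - t) *\<^sub>R y"
  \<comment> \<open>Both linear terms are multiples of this one number, \<open>(1 - t) * d\<close>
    at \<open>x\<close> and \<open>- t * d\<close> at \<open>y\<close>, so the weights
    \<open>t\<close> and \<open>1 - t\<close> cancel them.\<close>
  define d where "d = (x - y) \<bullet> g z"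
  have xz: "x - z = (1 - t) *\<^sub>R (x - y)" and yz: "y - z = - t *\<^sub>R (x - y)"
    by (simp_all add: z_def algebra_simps)
  have "f x - f z - (1 - t) * d \<le> \<kappa> / 2 * ((1 - t)\<^sup>2 * (norm (x - y))\<^sup>2)"
    using lipschitz_gradient_upper_bound[OF gradient lipschitz, of x z]
    by (simp add: xz d_def power_mult_distrib)
  then have bx: "t * (f x - f z - (1 - t) * d) \<le> t * (\<kappa> / 2 * ((1 - t)\<^sup>2 * (norm (x - y))\<^sup>2))"
    using t by (intro mult_left_mono)
  have "f y - f z + t * d \<le> \<kappa> / 2 * (t\<^sup>2 * (norm (x - y))\<^sup>2)"
    using lipschitz_gradient_upper_bound[OF gradient lipschitz, of y z]
    by (simp add: yz d_def power_mult_distrib)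
  then have "(1 - t) * (f y - f z + t * d) \<le> (1 - t) * (\<kappa> / 2 * (t\<^sup>2 * (norm (x - y))\<^sup>2))"
    using t by (intro mult_left_mono) auto
  with bx have "t * (f x - f z - (1 - t) * d) + (1 - t) * (f y - f z + t * d)
      \<le> t * (\<kappa> / 2 * ((1 - t)\<^sup>2 * (norm (x - y))\<^sup>2))
        + (1 - t) * (\<kappa> / 2 * (t\<^sup>2 * (norm (x - y))\<^sup>2))"
    by (rule add_mono)
  also have "\<dots> = t * (1 - t) * \<kappa> / 2 * (norm (x - y))\<^sup>2"
    by (simp add: field_simps power2_eq_square)
  also have "t * (f x - f z - (1 - t) * d) + (1 - t) * (f y - f z + t * d)
      = t * f x + (1 - t) * f y - f z"
    by (simp add: algebra_simps)
  finally show ?thesis by (simp add: z_def)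
qed

theorem proposition1:
  fixes f :: "real ^ 'd \<Rightarrow> real"
    and grad_f :: "real ^ 'd \<Rightarrow> real ^ 'd"
    and \<kappa> :: real
  assumes gradient: "\<And>x. GDERIV f x :> grad_f x"
    and kappa_nonneg: "\<kappa> \<ge> 0"
    and lipschitz: "\<And>x x'. norm (grad_f x - grad_f x') \<le> \<kappa> * norm (x - x')"
  shows "\<forall>x x'. \<forall>t\<in>{0..1::real}.
           \<bar>f (t *\<^sub>R x + (1 - t) *\<^sub>R x') - (t * f x + (1 - t) * f x')\<bar>
             \<le> t * (1 - t) * \<kappa> / 2 * (norm (x - x'))\<^sup>2"
proof (intro allI ballI)
  fix x x' :: "real ^ 'd" and t :: real
  assume "t \<in> {0..1}"
  then have t: "0 \<le> t" "t \<le> 1" by auto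
  \<comment> \<open>The convex combination lemma is one-sided. Since \<open>- f\<close> has a
    gradient with the same Lipschitz constant, applying the lemma to it as well bounds the
    difference from the other side.\<close>
  have neg_gradient: "GDERIV (\<lambda>x. - f x) x :> - grad_f x" for x
    by (rule GDERIV_minus) (rule gradient)
  have neg_lipschitz: "norm (- grad_f x - - grad_f x') \<le> \<kappa> * norm (x - x')" for x x'
    using lipschitz[of x' x] by (simp add: norm_minus_commute)
  show "\<bar>f (t *\<^sub>R x + (1 - t) *\<^sub>R x') - (t * f x + (1 - t) * f x')\<bar>
      \<le> t * (1 - t) * \<kappa> / 2 * (norm (x - x'))\<^sup>2"
    using lipschitz_gradient_convex_combination_upper[OF gradient lipschitz t, of x x']
      lipschitz_gradient_convex_combination_upper[OF neg_gradient neg_lipschitz t, of x x']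
    by linarith
qed

end
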